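(* Let $p$ be a prime and let $f(n)=(a_1n+b_1)(a_2n+b_2)$, where $a_i,b_i\in\mathbb{Z}$, $a_i\neq 0$, and $\gcd(a_i,b_i)=1$ for $i\in\{1,2\}$. Consider the roots $-\frac{b_1}{a_1}$ and $-\frac{b_2}{a_2}$ of $f$. (i) If $-\frac{b_1}{a_1}=-\frac{b_2}{a_2}$, then the $p$-adic valuation tree of $\{\nu_p(f(n))\}_{n\ge 0}$ has the same terminating and non-terminating nodes as the tree of $\{\nu_p(a_1n+b_1)\}_{n\ge 0}$, and the valuations at these nodes are twice what they are for $\{\nu_p(a_1n+b_1)\}_{n\ge 0}$. (ii) If $-\frac{b_2}{a_2}\notin\mathbb{Z}_p$, then the tree of $\{\nu_p(f(n))\}_{n\ge 0}$ has the same terminating and non-terminating nodes as the tree of $\{\nu_p(a_1n+b_1)\}_{n\ge 0}$, and the terminating nodes have the same valuations as those on the tree of $\{\nu_p(a_1n+b_1)\}_{n\ge 0}$. (iii) Suppose $-\frac{b_1}{a_1},-\frac{b_2}{a_2}\in\mathbb{Z}_p$ and $-\frac{b_1}{a_1}\neq-\frac{b_2}{a_2}$. Let $r\ge 0$ be the integer such that $-\frac{b_1}{a_1}\equiv-\frac{b_2}{a_2}\pmod{p^r}$ and $-\frac{b_1}{a_1}\not\equiv-\frac{b_2}{a_2}\pmod{p^{r+1}}$ (so $r=0$ if the roots are not congruent modulo $p$). Then in the tree of $\{\nu_p(f(n))\}_{n\ge 0}$: - for $0\le k\le r-1$, the non-terminating node at the $k$-th level splits into $p-1$ terminating nodes with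 valuation $2k$ and one non-terminating node with valuation at least $2(k+1)$; - at the $r$-th level, the non-terminating node splits into $p-2$ terminating nodes with valuation $2r$ and two non-terminating nodes with valuation at least $2r+1$; - for $k\ge r+1$, a non-terminating node at the $k$-th level splits into $p-1$ terminating nodes with valuation $k+r$ and one non-terminating node with valuation at least $k+1+r$.
   Context: For a prime $p$, $\nu_p$ is the usual $p$-adic valuation on $\mathbb{Q}$, with $\nu_p(0)=+\infty$; $\mathbb{Z}_p$ is the ring of $p$-adic integers, and congruences between elements of $\mathbb{Z}_p$ modulo $p^r$ are taken modulo $p^r\mathbb{Z}_p$. Valuation tree. Given a sequence of rational numbers $\{S_n\}_{n\ge 0}$, the $p$-adic valuation tree of $\{\nu_p(S_n)\}_{n\ge 0}$ is built as follows. The $0$-th level has a single node, containing all terms of the sequence. A node at level $k$ consists of the terms $S_m$ whose index $m$ has the form $m=c_0+c_1p+\cdots+c_{k-1}p^{k-1}+np^k$, $n\ge 0$, for fixed digits $0\le c_i\le p-1$; nodes of trees of different sequences are identified when they have the same set of indices. A node is terminating if $\nu_p(S_m)$ has the same value for all terms $S_m$ in the node (this common value is "the valuation" of the node); it is non-terminating if at least two terms in the node have different valuations. A terminating node does not split. A non-terminating node at level $k$ splits into the $p$ nodes at level $k+1$ whose indices are $m=c_0+\cdots+c_{k-1}p^{k-1}+c_kp^k+np^{k+1}$, $n\ge 0$, one for each $0\le c_k\le p-1$. A node has "valuation at least $v$" if $\nu_p(S_m)\ge v$ for all terms $S_m$ in it. *)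

theory Defs
  imports "HOL-Computational_Algebra.Primes" "HOL-Library.Extended_Real"
begin

(* The value group with +oo adjoined is embedded in ereal. The case 0 is separate because
   multiplicity p 0 = 0. *)
definition padic_val :: "nat \<Rightarrow> rat \<Rightarrow> ereal" where
  "padic_val p x =
     (if x = 0 then \<infinity>
      else ereal (real (multiplicity (int p) (fst (quotient_of x)))
                  - real (multiplicity (int p) (snd (quotient_of x)))))"

(* The rational elements of the ring of p-adic integers {x in Q_p. nu_p(x) >= 0}. *)
definition padic_ints :: "nat \<Rightarrow> rat set" where
  "padic_ints p = {x. padic_val p x \<ge> 0}"

(* Congruence modulo p^r Z_p. For rational x and y a witness z in Z_p is itself rational. *)
definition padic_cong :: "nat \<Rightarrow> nat \<Rightarrow> rat \<Rightarrow> rat \<Rightarrow> bool" where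
  "padic_cong p r x y \<longleftrightarrow> (\<exists>z\<in>padic_ints p. x - y = of_nat p ^ r * z)"

(* A node is represented by the set of indices of its terms. Only c 0, ..., c (k - 1) matter. *)
definition index_class :: "nat \<Rightarrow> nat \<Rightarrow> (nat \<Rightarrow> nat) \<Rightarrow> nat set" where
  "index_class p k c = {(\<Sum>i<k. c i * p ^ i) + n * p ^ k | n. True}"

definition terminating :: "nat \<Rightarrow> (nat \<Rightarrow> rat) \<Rightarrow> nat set \<Rightarrow> bool" where
  "terminating p S N \<longleftrightarrow> (\<forall>m\<in>N. \<forall>m'\<in>N. padic_val p (S m) = padic_val p (S m'))"

definition has_valuation :: "nat \<Rightarrow> (nat \<Rightarrow> rat) \<Rightarrow> nat set \<Rightarrow> ereal \<Rightarrow> bool" where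
  "has_valuation p S N v \<longleftrightarrow> (\<forall>m\<in>N. padic_val p (S m) = v)"

definition valuation_at_least :: "nat \<Rightarrow> (nat \<Rightarrow> rat) \<Rightarrow> nat set \<Rightarrow> ereal \<Rightarrow> bool" where
  "valuation_at_least p S N v \<longleftrightarrow> (\<forall>m\<in>N. padic_val p (S m) \<ge> v)"

(* The p index sets into which the level-k index set N splits; the parent and the child share
   the digits c 0, ..., c (k - 1), and c k is the new digit. *)
definition children :: "nat \<Rightarrow> nat \<Rightarrow> nat set \<Rightarrow> nat set set" where
  "children p k N =
     {index_class p (Suc k) c | c. (\<forall>i\<le>k. c i < p) \<and> N = index_class p k c}"

primrec tree_level :: "nat \<Rightarrow> (nat \<Rightarrow> rat) \<Rightarrow> nat \<Rightarrow> nat set set" where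
  "tree_level p S 0 = {UNIV}"
| "tree_level p S (Suc k) =
     (\<Union>N\<in>{N \<in> tree_level p S k. \<not> terminating p S N}. children p k N)"

definition terminating_nodes :: "nat \<Rightarrow> (nat \<Rightarrow> rat) \<Rightarrow> nat set set" where
  "terminating_nodes p S = {N \<in> (\<Union>k. tree_level p S k). terminating p S N}"

definition nonterminating_nodes :: "nat \<Rightarrow> (nat \<Rightarrow> rat) \<Rightarrow> nat set set" where
  "nonterminating_nodes p S = {N \<in> (\<Union>k. tree_level p S k). \<not> terminating p S N}"

(* The children of the level-k node N are exactly s terminating nodes, all of valuation v,
   and t non-terminating nodes, all of valuation at least w. *)
definition splits_into ::
    "nat \<Rightarrow> (nat \<Rightarrow> rat) \<Rightarrow> nat \<Rightarrow> nat set \<Rightarrow> nat \<Rightarrow> ereal \<Rightarrow> nat \<Rightarrow> ereal \<Rightarrow> bool" where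
  "splits_into p S k N s v t w \<longleftrightarrow>
     finite (children p k N) \<and>
     card {M \<in> children p k N. terminating p S M} = s \<and>
     (\<forall>M\<in>children p k N. terminating p S M \<longrightarrow> has_valuation p S M v) \<and>
     card {M \<in> children p k N. \<not> terminating p S M} = t \<and>
     (\<forall>M\<in>children p k N. \<not> terminating p S M \<longrightarrow> valuation_at_least p S M w)"

end

theory Submission
  imports Defs "HOL-Computational_Algebra.Squarefree" "HOL-Number_Theory.Cong"
begin

text \<open>
  For an integer \<open>x\<close>, the bound \<open>padic_val p x \<ge> k\<close> means \<open>p ^ k dvd x\<close>, and nodes of level \<open>k\<close>
  are residue classes modulo \<open>p ^ k\<close>. A valuation tree depends on the sequence only through the
  predicate \<^const>\<open>terminating\<close>. If the two roots agree, the linear factors agree up to sign, so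
  the valuation of \<open>f\<close> is twice that of the factor; if the second root is not
  \<open>p\<close>-integral, then \<open>p\<close> divides \<open>a2\<close> but not \<open>b2\<close>, so the second factor has valuation \<open>0\<close>. In both
  cases the predicate is the same for \<open>f\<close> and for the first factor.

  If both roots are \<open>p\<close>-integral, then \<open>p\<close> divides neither \<open>a1\<close> nor \<open>a2\<close>. Hence the indices \<open>n\<close> with
  \<open>p ^ k dvd a\<^sub>i n + b\<^sub>i\<close> form a single residue class \<open>Z\<^sub>i k\<close> modulo \<open>p ^ k\<close>, the class of the
  \<open>i\<close>-th root. The identity
  \<open>a1 (a2 n + b2) - a2 (a1 n + b1) = a1 b2 - a2 b1\<close>, whose right-hand side is divisible by exactly
  \<open>p ^ r\<close>, shows that \<open>Z\<^sub>1 k = Z\<^sub>2 k\<close> for \<open>k \<le> r\<close> and that \<open>Z\<^sub>1 k\<close> and \<open>Z\<^sub>2 k\<close> are disjoint for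
  \<open>k > r\<close>. It follows that \<open>f\<close> has valuation at least \<open>k + min k r\<close> on \<open>Z\<^sub>i k\<close>, with equality outside
  \<open>Z\<^sub>1 (k + 1) \<union> Z\<^sub>2 (k + 1)\<close>. Each \<open>Z\<^sub>i k\<close> is non-terminating, because \<open>f\<close> takes there arbitrarily
  large valuations but has only finitely many zeros. So the non-terminating nodes of level \<open>k\<close> are
  exactly \<open>Z\<^sub>1 k\<close> and \<open>Z\<^sub>2 k\<close>, and the three ranges of \<open>k\<close> only differ in how many of the two classes
  \<open>Z\<^sub>1 (k + 1)\<close>, \<open>Z\<^sub>2 (k + 1)\<close> are distinct children of a given node.
\<close>

section \<open>Valuations of integers and of roots of linear forms\<close>

lemma padic_val_of_int:
  "padic_val p (of_int x) = (if x = 0 then \<infinity> else ereal (real (multiplicity (int p) x)))"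
  by (simp add: padic_val_def)

lemma padic_val_ge_iff:
  assumes "prime p"
  shows "padic_val p (of_int x) \<ge> ereal (real k) \<longleftrightarrow> int p ^ k dvd x"
proof (cases "x = 0")
  case False
  have "prime (int p)"
    using assms by simp
  then have "\<not> is_unit (int p)"
    using not_prime_unit by blast
  then show ?thesis
    using False by (simp add: padic_val_of_int power_dvd_iff_le_multiplicity)
qed (simp add: padic_val_def)

lemma padic_val_eqI:
  assumes "prime p" "int p ^ k dvd x" "\<not> int p ^ Suc k dvd x"
  shows "padic_val p (of_int x) = ereal (real k)"
proof -
  have "x \<noteq> 0"
    using assms(3) by auto
  moreover have "multiplicity (int p) x = k"
    using assms by (intro multiplicity_eqI) auto
  ultimately show ?thesis
    by (simp add: padic_val_of_int)
qed

lemma padic_val_mult: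
  assumes "prime p"
  shows "padic_val p (of_int (x * y)) = padic_val p (of_int x) + padic_val p (of_int y)"
proof (cases "x = 0 \<or> y = 0")
  case False
  have "prime_elem (int p)"
    using assms by simp
  then show ?thesis
    using False unfolding padic_val_of_int
    by (simp add: prime_elem_multiplicity_mult_distrib)
qed (auto simp: padic_val_def)

text \<open>
  Membership in \<^const>\<open>padic_ints\<close> is witnessed by any representation with denominator prime to
  \<open>p\<close>, reduced or not.
\<close>

lemma padic_ints_iff:
  assumes "prime p"
  shows "x \<in> padic_ints p \<longleftrightarrow> (\<exists>c d. \<not> int p dvd d \<and> x * of_int d = of_int c)"
proof -
  obtain u v where uv: "quotient_of x = (u, v)"
    by fastforce
  have v: "v > 0" and cop: "coprime u v" and x: "x = of_int u / of_int v"
    using quotient_of_denom_pos[OF uv] quotient_of_coprime[OF uv] quotient_of_div[OF uv] by auto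
  have p: "prime (int p)"
    using assms by simp
  have ndvd: "\<not> (int p dvd u \<and> int p dvd v)"
    using cop p coprime_common_divisor not_prime_unit by blast
  have "x \<in> padic_ints p \<longleftrightarrow> \<not> int p dvd v"
  proof (cases "int p dvd v")
    case True
    then have "\<not> int p dvd u"
      using ndvd by blast
    moreover have "multiplicity (int p) v > 0"
      using True v p by (simp add: prime_multiplicity_gt_zero_iff)
    moreover have "x \<noteq> 0"
      using x v \<open>\<not> int p dvd u\<close> by auto
    ultimately show ?thesis
      using True uv by (simp add: padic_ints_def padic_val_def not_dvd_imp_multiplicity_0)
  next
    case False
    then show ?thesis
      using uv by (simp add: padic_ints_def padic_val_def not_dvd_imp_multiplicity_0)
  qed
  moreover have "\<not> int p dvd v" if "\<not> int p dvd d" "x * of_int d = of_int c" for c d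
  proof
    assume dv: "int p dvd v"
    have "(of_int (u * d) :: rat) = of_int (c * v)"
      using that(2) v by (simp add: x field_simps)
    then have "u * d = c * v"
      using of_int_eq_iff by blast
    then have "int p dvd u * d"
      using dv by simp
    then show False
      using p that(1) dv ndvd prime_dvd_mult_iff by blast
  qed
  moreover have "x * of_int v = of_int u"
    using v by (simp add: x)
  ultimately show ?thesis
    by blast
qed

lemma root_in_padic_ints_iff:
  assumes "prime p" "a \<noteq> 0" "gcd a b = 1"
  shows "- (of_int b / of_int a) \<in> padic_ints p \<longleftrightarrow> \<not> int p dvd a"
proof
  have p: "prime (int p)"
    using assms by simp
  assume "- (of_int b / of_int a) \<in> padic_ints p"
  then obtain c d where d: "\<not> int p dvd d"
    and eq: "- (of_int b / of_int a) * of_int d = (of_int c :: rat)"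
    using padic_ints_iff[OF assms(1)] by blast
  have "(of_int (- b * d) :: rat) = of_int (c * a)"
    using eq assms(2) by (simp add: field_simps)
  then have eq': "- b * d = c * a"
    using of_int_eq_iff by blast
  show "\<not> int p dvd a"
  proof
    assume dvd: "int p dvd a"
    then have "int p dvd - b * d"
      unfolding eq' by simp
    then have "int p dvd b"
      using prime_dvd_mult_iff[OF p] d by simp
    then have "int p dvd gcd a b"
      using dvd by simp
    then show False
      using assms(3) p not_prime_unit by auto
  qed
next
  assume "\<not> int p dvd a"
  moreover have "- (of_int b / of_int a) * of_int a = (of_int (- b) :: rat)"
    using assms(2) by simp
  ultimately show "- (of_int b / of_int a) \<in> padic_ints p"
    using padic_ints_iff[OF assms(1)] by blast
qed

text \<open>Congruence of the two roots is divisibility of the resultant of the two linear forms.\<close>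

lemma padic_cong_roots_iff:
  assumes "prime p" "\<not> int p dvd a1" "\<not> int p dvd a2"
  shows "padic_cong p r (- (of_int b1 / of_int a1)) (- (of_int b2 / of_int a2))
           \<longleftrightarrow> int p ^ r dvd a1 * b2 - a2 * b1"
proof -
  have p: "prime (int p)" and nz: "a1 \<noteq> 0" "a2 \<noteq> 0"
    using assms by auto
  show ?thesis
  proof
    assume "padic_cong p r (- (of_int b1 / of_int a1)) (- (of_int b2 / of_int a2))"
    then obtain z where "z \<in> padic_ints p"
      and z: "- (of_int b1 / of_int a1) - - (of_int b2 / of_int a2) = of_nat p ^ r * z"
      unfolding padic_cong_def by blast
    then obtain c d where d: "\<not> int p dvd d" and zd: "z * of_int d = of_int c"
      using padic_ints_iff[OF assms(1)] by blast
    have "(of_int ((a1 * b2 - a2 * b1) * d) :: rat)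
            = (- (of_int b1 / of_int a1) - - (of_int b2 / of_int a2))
                * of_int d * of_int (a1 * a2)"
      using nz by (simp add: field_simps)
    also have "\<dots> = of_nat p ^ r * (z * of_int d) * of_int (a1 * a2)"
      unfolding z by (simp add: mult_ac)
    also have "\<dots> = of_int (int p ^ r * (c * (a1 * a2)))"
      unfolding zd by (simp add: mult_ac)
    finally have "(a1 * b2 - a2 * b1) * d = int p ^ r * (c * (a1 * a2))"
      using of_int_eq_iff by blast
    then have "int p ^ r dvd (a1 * b2 - a2 * b1) * d"
      by simp
    moreover have "coprime (int p ^ r) d"
      using p d by (simp add: prime_imp_coprime)
    ultimately show "int p ^ r dvd a1 * b2 - a2 * b1"
      by (simp add: coprime_dvd_mult_left_iff)
  next
    assume "int p ^ r dvd a1 * b2 - a2 * b1"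
    then obtain e where e: "a1 * b2 - a2 * b1 = int p ^ r * e"
      by blast
    define z :: rat where "z = of_int e / of_int (a1 * a2)"
    have "\<not> int p dvd a1 * a2"
      using p assms prime_dvd_mult_iff by blast
    moreover have "z * of_int (a1 * a2) = of_int e"
      using nz by (simp add: z_def)
    ultimately have "z \<in> padic_ints p"
      using padic_ints_iff[OF assms(1)] by blast
    moreover have "- (of_int b1 / of_int a1) - - (of_int b2 / of_int a2)
                     = (of_int (a1 * b2 - a2 * b1) / of_int (a1 * a2) :: rat)"
      using nz by (simp add: field_simps)
    then have "- (of_int b1 / of_int a1) - - (of_int b2 / of_int a2) = of_nat p ^ r * z"
      unfolding e by (simp add: z_def)
    ultimately show "padic_cong p r (- (of_int b1 / of_int a1)) (- (of_int b2 / of_int a2))"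
      unfolding padic_cong_def by blast
  qed
qed

section \<open>Nodes as residue classes\<close>

text \<open>The natural numbers congruent to \<open>a\<close> modulo \<open>q\<close>; here \<open>a\<close> need not be reduced.\<close>

definition residue_class :: "nat \<Rightarrow> nat \<Rightarrow> nat set" where
  "residue_class q a = {m. m mod q = a mod q}"

lemma residue_class_eq_iff: "residue_class q a = residue_class q b \<longleftrightarrow> a mod q = b mod q"
  by (auto simp: residue_class_def)

lemma residue_class_self: "a \<in> residue_class q a"
  by (simp add: residue_class_def)

lemma residue_class_eqI: "m \<in> residue_class q a \<Longrightarrow> residue_class q m = residue_class q a"
  by (simp add: residue_class_def)

lemma digit_sum_less:
  fixes p :: nat
  assumes "\<And>i. i < k \<Longrightarrow> c i < p"
  shows "(\<Sum>i<k. c i * p ^ i) < p ^ k"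
  using assms
proof (induction k)
  case (Suc k)
  have "(\<Sum>i<Suc k. c i * p ^ i) < p ^ k + c k * p ^ k"
    using Suc by simp
  also have "\<dots> = Suc (c k) * p ^ k"
    by simp
  also have "\<dots> \<le> p * p ^ k"
    using Suc.prems[of k] by (intro mult_right_mono) auto
  finally show ?case
    by simp
qed simp

lemma digit_sum_digits: "(\<Sum>i<k. (m div p ^ i mod p) * p ^ i) = m mod (p ^ k :: nat)"
proof (induction k)
  case (Suc k)
  have "m mod p ^ Suc k = p ^ k * (m div p ^ k mod p) + m mod p ^ k"
    using mod_mult2_eq[of m "p ^ k" p] by (simp add: mult.commute)
  with Suc show ?case
    by simp
qed simp

text \<open>
  The digits have to be proper: an index class contains no index below its digit sum, so it is
  a full residue class only if that sum is less than \<open>p ^ k\<close>.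
\<close>

lemma index_class_eq:
  assumes "\<And>i. i < k \<Longrightarrow> c i < p"
  shows "index_class p k c = residue_class (p ^ k) (\<Sum>i<k. c i * p ^ i)" (is "_ = residue_class _ ?s")
proof -
  have s: "?s mod p ^ k = ?s"
    using digit_sum_less[OF assms] by simp
  show ?thesis
  proof (intro equalityI subsetI)
    fix m assume "m \<in> residue_class (p ^ k) ?s"
    then have "m mod p ^ k = ?s"
      by (simp add: residue_class_def s)
    then have "m = ?s + (m div p ^ k) * p ^ k"
      using mod_mult_div_eq[of m "p ^ k"] by (simp add: mult.commute)
    then show "m \<in> index_class p k c"
      unfolding index_class_def by blast
  qed (auto simp: index_class_def residue_class_def)
qed

lemma index_class_digits:
  assumes "p > 0"
  shows "index_class p k (\<lambda>i. m div p ^ i mod p) = residue_class (p ^ k) m"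
  using assms by (subst index_class_eq) (simp_all add: digit_sum_digits residue_class_eq_iff)

text \<open>
  The children of a node are the residue classes modulo \<open>p ^ Suc k\<close> of its elements, so digit
  expansions are not needed any more.
\<close>

lemma children_residue_class:
  assumes "p > 0"
  shows "children p k (residue_class (p ^ k) a)
           = residue_class (p ^ Suc k) ` residue_class (p ^ k) a"
proof (intro equalityI subsetI)
  fix M assume "M \<in> children p k (residue_class (p ^ k) a)"
  then obtain c where M: "M = index_class p (Suc k) c" and c: "\<And>i. i \<le> k \<Longrightarrow> c i < p"
    and N: "residue_class (p ^ k) a = index_class p k c"
    unfolding children_def by blast
  have "M = residue_class (p ^ Suc k) (\<Sum>i<Suc k. c i * p ^ i)"
    unfolding M using c by (intro index_class_eq) simp
  moreover have "(\<Sum>i<Suc k. c i * p ^ i) \<in> residue_class (p ^ k) a"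
    unfolding N using c by (subst index_class_eq) (simp_all add: residue_class_def)
  ultimately show "M \<in> residue_class (p ^ Suc k) ` residue_class (p ^ k) a"
    by blast
next
  fix M assume "M \<in> residue_class (p ^ Suc k) ` residue_class (p ^ k) a"
  then obtain m where m: "m \<in> residue_class (p ^ k) a" and M: "M = residue_class (p ^ Suc k) m"
    by blast
  let ?c = "\<lambda>i. m div p ^ i mod p"
  have "M = index_class p (Suc k) ?c" "residue_class (p ^ k) a = index_class p k ?c"
    using m M assms by (simp_all add: index_class_digits residue_class_eqI del: power_Suc)
  moreover have "\<forall>i\<le>k. ?c i < p"
    using assms by simp
  ultimately show "M \<in> children p k (residue_class (p ^ k) a)"
    unfolding children_def by blast
qed

lemma card_children_residue_class:
  assumes "p > 0"
  shows "finite (children p k (residue_class (p ^ k) a))"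
    and "card (children p k (residue_class (p ^ k) a)) = p"
proof -
  \<comment> \<open>The child that belongs to the new digit \<open>d\<close>.\<close>
  let ?h = "\<lambda>d. residue_class (p ^ Suc k) (a mod p ^ k + d * p ^ k)"
  have small: "a mod p ^ k + d * p ^ k < p ^ Suc k" if "d < p" for d
  proof -
    have "a mod p ^ k + d * p ^ k < Suc d * p ^ k"
      using assms by simp
    also have "\<dots> \<le> p * p ^ k"
      using that by (intro mult_right_mono) auto
    finally show ?thesis
      by simp
  qed
  have eq: "children p k (residue_class (p ^ k) a) = ?h ` {..<p}"
  proof (intro equalityI subsetI)
    fix M assume "M \<in> children p k (residue_class (p ^ k) a)"
    then obtain m where m: "m mod p ^ k = a mod p ^ k" and M: "M = residue_class (p ^ Suc k) m"
      unfolding children_residue_class[OF assms] by (auto simp: residue_class_def)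
    have "m mod p ^ Suc k = a mod p ^ k + (m div p ^ k mod p) * p ^ k"
      using mod_mult2_eq[of m "p ^ k" p] m by (simp add: mult.commute)
    then have "m mod p ^ Suc k = (a mod p ^ k + (m div p ^ k mod p) * p ^ k) mod p ^ Suc k"
      by (metis mod_mod_trivial)
    then have "M = ?h (m div p ^ k mod p)"
      unfolding M residue_class_eq_iff .
    moreover have "m div p ^ k mod p < p"
      using assms by simp
    ultimately show "M \<in> ?h ` {..<p}"
      by blast
  next
    fix M assume "M \<in> ?h ` {..<p}"
    then show "M \<in> children p k (residue_class (p ^ k) a)"
      unfolding children_residue_class[OF assms] by (auto simp: residue_class_def)
  qed
  have "inj_on ?h {..<p}"
  proof (rule inj_onI)
    fix d e assume de: "d \<in> {..<p}" "e \<in> {..<p}" and "?h d = ?h e"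
    then have "a mod p ^ k + d * p ^ k = a mod p ^ k + e * p ^ k"
      unfolding residue_class_eq_iff using small by simp
    then show "d = e"
      using assms by simp
  qed
  then show "finite (children p k (residue_class (p ^ k) a))"
    and "card (children p k (residue_class (p ^ k) a)) = p"
    unfolding eq by (simp_all add: card_image)
qed

text \<open>A valuation tree depends on its sequence only through the predicate \<^const>\<open>terminating\<close>.\<close>

lemma tree_level_cong:
  assumes "\<And>N. terminating p f N \<longleftrightarrow> terminating p g N"
  shows "tree_level p f k = tree_level p g k"
  by (induction k) (simp_all add: assms)

lemma nodes_cong:
  assumes "\<And>N. terminating p f N \<longleftrightarrow> terminating p g N"
  shows "terminating_nodes p f = terminating_nodes p g"
    and "nonterminating_nodes p f = nonterminating_nodes p g"
  unfolding terminating_nodes_def nonterminating_nodes_def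
  by (simp_all add: assms tree_level_cong[OF assms])

section \<open>The residue class of a root\<close>

text \<open>
  If \<open>p\<close> does not divide \<open>a\<close>, these are the indices congruent to the root \<open>- b / a\<close> modulo
  \<open>p ^ k\<close>; using the linear form avoids \<open>p\<close>-adic arithmetic.
\<close>

definition root_class :: "nat \<Rightarrow> int \<Rightarrow> int \<Rightarrow> nat \<Rightarrow> nat set" where
  "root_class p a b k = {n. int p ^ k dvd a * int n + b}"

lemma root_class_antimono: "j \<le> k \<Longrightarrow> root_class p a b k \<subseteq> root_class p a b j"
  unfolding root_class_def using power_le_dvd by blast

lemma root_class_nonempty:
  assumes "prime p" "\<not> int p dvd a"
  shows "root_class p a b k \<noteq> {}"
proof -
  have "coprime (int p ^ k) a"
    using assms by (simp add: prime_imp_coprime)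
  then have "coprime a (int p ^ k)"
    by (simp only: coprime_commute)
  then obtain x where x: "[a * x = 1] (mod int p ^ k)"
    using cong_solve_coprime_int by blast
  define n where "n = nat ((- b * x) mod int p ^ k)"
  have "int p ^ k > 0"
    using assms(1) prime_gt_0_nat by simp
  then have "[int n = - b * x] (mod int p ^ k)"
    unfolding n_def by simp
  then have "[a * int n + b = a * (- b * x) + b] (mod int p ^ k)"
    by (intro cong_add cong_mult cong_refl)
  also have "a * (- b * x) + b = - b * (a * x) + b"
    by simp
  also have "[- b * (a * x) + b = - b * 1 + b] (mod int p ^ k)"
    by (intro cong_add cong_mult cong_refl x)
  finally have "n \<in> root_class p a b k"
    by (simp add: root_class_def cong_0_iff)
  then show ?thesis
    by blast
qed

lemma root_class_eq_residue_class:
  assumes "prime p" "\<not> int p dvd a" "n \<in> root_class p a b k"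
  shows "root_class p a b k = residue_class (p ^ k) n"
proof -
  have cop: "coprime (int p ^ k) a"
    using assms by (simp add: prime_imp_coprime)
  have n: "int p ^ k dvd a * int n + b"
    using assms(3) by (simp add: root_class_def)
  have "m \<in> root_class p a b k \<longleftrightarrow> m \<in> residue_class (p ^ k) n" for m
  proof -
    have "m \<in> root_class p a b k \<longleftrightarrow> int p ^ k dvd a * int m + b - (a * int n + b)"
      unfolding root_class_def mem_Collect_eq using n by (metis dvd_diff diff_add_cancel dvd_add)
    also have "a * int m + b - (a * int n + b) = a * (int m - int n)"
      by (simp add: algebra_simps)
    also have "int p ^ k dvd \<dots> \<longleftrightarrow> [int m = int n] (mod int (p ^ k))"
      using cop by (simp add: coprime_dvd_mult_right_iff cong_iff_dvd_diff)
    also have "\<dots> \<longleftrightarrow> m \<in> residue_class (p ^ k) n"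
      by (simp only: cong_int_iff) (simp add: residue_class_def cong_def)
    finally show ?thesis .
  qed
  then show ?thesis
    by blast
qed

section \<open>Two integral roots\<close>

text \<open>
  The situation of two distinct \<open>p\<close>-integral roots that are congruent modulo \<open>p ^ r\<close> but not modulo
  \<open>p ^ Suc r\<close>, expressed by divisibility of integers: neither leading coefficient is divisible by
  \<open>p\<close>, and \<open>p ^ r\<close> is the exact power of \<open>p\<close> in the resultant. The situation is symmetric in the two
  linear forms, so facts are stated for the first root and transferred to the second.
\<close>

locale two_integral_roots =
  fixes p r :: nat and a1 b1 a2 b2 :: int and f :: "nat \<Rightarrow> rat"
  assumes p: "prime p"
    and a1: "\<not> int p dvd a1" and a2: "\<not> int p dvd a2"
    and r: "int p ^ r dvd a1 * b2 - a2 * b1" "\<not> int p ^ Suc r dvd a1 * b2 - a2 * b1"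
    and f: "f n = of_int ((a1 * int n + b1) * (a2 * int n + b2))"
begin

lemma swapped: "two_integral_roots p r a2 b2 a1 b1 f"
proof
  have "a2 * b1 - a1 * b2 = - (a1 * b2 - a2 * b1)"
    by simp
  then show "int p ^ r dvd a2 * b1 - a1 * b2" "\<not> int p ^ Suc r dvd a2 * b1 - a1 * b2"
    using r by (metis dvd_minus_iff)+
qed (simp_all add: p a1 a2 f mult.commute)

abbreviation "Z1 \<equiv> root_class p a1 b1"
abbreviation "Z2 \<equiv> root_class p a2 b2"

lemma p_pos: "p > 0"
  using p prime_gt_0_nat by blast

lemma Z1_0: "Z1 0 = UNIV" and Z2_0: "Z2 0 = UNIV"
  by (simp_all add: root_class_def)

lemma resultant_identity:
  "a1 * (a2 * int n + b2) - a2 * (a1 * int n + b1) = a1 * b2 - a2 * b1"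
  by (simp add: algebra_simps)

lemma Z1_subset_Z2:
  assumes "k \<le> r"
  shows "Z1 k \<subseteq> Z2 k"
proof
  fix n assume "n \<in> Z1 k"
  then have "int p ^ k dvd a2 * (a1 * int n + b1)"
    by (simp add: root_class_def)
  moreover have "int p ^ k dvd a1 * b2 - a2 * b1"
    using r(1) assms power_le_dvd by blast
  ultimately have "int p ^ k dvd a1 * (a2 * int n + b2)"
    by (metis resultant_identity dvd_add diff_add_cancel)
  moreover have "coprime (int p ^ k) a1"
    using p a1 by (simp add: prime_imp_coprime)
  ultimately show "n \<in> Z2 k"
    by (simp add: root_class_def coprime_dvd_mult_right_iff)
qed

lemma Z1_eq_Z2: "k \<le> r \<Longrightarrow> Z1 k = Z2 k"
  using Z1_subset_Z2 two_integral_roots.Z1_subset_Z2[OF swapped] by blast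

lemma Z1_Z2_disjoint:
  assumes "k > r"
  shows "Z1 k \<inter> Z2 k = {}"
proof (rule ccontr)
  assume "Z1 k \<inter> Z2 k \<noteq> {}"
  then obtain n where "n \<in> Z1 k" "n \<in> Z2 k"
    by blast
  then have "int p ^ k dvd a1 * (a2 * int n + b2) - a2 * (a1 * int n + b1)"
    by (simp add: root_class_def)
  then have "int p ^ Suc r dvd a1 * b2 - a2 * b1"
    unfolding resultant_identity using assms power_le_dvd Suc_leI by blast
  then show False
    using r(2) by blast
qed

lemma Z1_nonempty: "Z1 k \<noteq> {}"
  using root_class_nonempty[OF p a1] .

text \<open>
  A lower bound for the valuation on \<open>Z1 k\<close>: the first factor contributes at least \<open>k\<close>, the second
  at least \<open>min k r\<close>.
\<close>

lemma val_ge_Z1: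
  assumes "n \<in> Z1 k"
  shows "padic_val p (f n) \<ge> ereal (real (k + min k r))"
proof -
  have "n \<in> Z1 (min k r)"
    using assms root_class_antimono[of "min k r" k] by auto
  then have "n \<in> Z2 (min k r)"
    using Z1_subset_Z2[of "min k r"] by auto
  then have "int p ^ k * int p ^ min k r dvd (a1 * int n + b1) * (a2 * int n + b2)"
    using assms unfolding root_class_def by (intro mult_dvd_mono) auto
  then show ?thesis
    unfolding f padic_val_ge_iff[OF p] power_add .
qed

text \<open>
  Off the classes of level \<open>Suc k\<close> the bound is attained. For \<open>k > r\<close> the second factor has
  valuation exactly \<open>r\<close>, since \<open>Z1 (Suc r)\<close> lies in \<open>Z2 r\<close> but is disjoint from \<open>Z2 (Suc r)\<close>.
\<close>

lemma val_eq_Z1: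
  assumes "n \<in> Z1 k" "n \<notin> Z1 (Suc k)" "n \<notin> Z2 (Suc k)"
  shows "padic_val p (f n) = ereal (real (k + min k r))"
proof -
  have "n \<in> Z1 (min k r)"
    using assms root_class_antimono[of "min k r" k] by auto
  then have in2: "n \<in> Z2 (min k r)"
    using Z1_subset_Z2[of "min k r"] by auto
  have notin2: "n \<notin> Z2 (Suc (min k r))"
  proof (cases "k \<le> r")
    case False
    then have "n \<in> Z1 (Suc r)"
      using assms(1) root_class_antimono[of "Suc r" k] by auto
    then show ?thesis
      using False Z1_Z2_disjoint[of "Suc r"] by auto
  qed (use assms in auto)
  have "padic_val p (of_int (a1 * int n + b1)) = ereal (real k)"
    using assms by (intro padic_val_eqI p) (auto simp: root_class_def)
  moreover have "padic_val p (of_int (a2 * int n + b2)) = ereal (real (min k r))"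
    using in2 notin2 by (intro padic_val_eqI p) (auto simp: root_class_def)
  ultimately show ?thesis
    unfolding f padic_val_mult[OF p] by simp
qed

lemma finite_zeros: "finite {n. f n = 0}"
proof -
  have fin: "finite {n. a * int n + b = 0}" if "\<not> int p dvd a" for a b
  proof -
    have "a \<noteq> 0"
      using that by auto
    then have "inj (\<lambda>n. a * int n + b)"
      by (intro injI) simp
    then show ?thesis
      using finite_vimageI[of "{0}" "\<lambda>n. a * int n + b"] by (simp add: vimage_def)
  qed
  have "{n. f n = 0} \<subseteq> {n. a1 * int n + b1 = 0} \<union> {n. a2 * int n + b2 = 0}"
    unfolding f by (auto simp del: of_int_mult of_int_add)
  then show ?thesis
    using fin[OF a1, of b1] fin[OF a2, of b2] finite_subset by blast
qed

text \<open>
  Some index in \<open>Z1 k\<close> has a finite valuation \<open>v\<close>, because \<open>f\<close> has finitely many zeros, and the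
  subset \<open>Z1 (k + Suc v)\<close> contains an index of larger valuation.
\<close>

lemma nonterminating_Z1: "\<not> terminating p f (Z1 k)"
proof
  assume t: "terminating p f (Z1 k)"
  obtain m where m: "m \<in> Z1 k"
    using Z1_nonempty by blast
  have res: "Z1 k = residue_class (p ^ k) m"
    using root_class_eq_residue_class[OF p a1 m] .
  have "infinite (range (\<lambda>j. m + j * p ^ k))"
    using p_pos by (intro range_inj_infinite injI) simp
  moreover have "range (\<lambda>j. m + j * p ^ k) \<subseteq> Z1 k"
    unfolding res by (auto simp: residue_class_def)
  ultimately have "infinite (Z1 k)"
    using finite_subset by blast
  then obtain n where n: "n \<in> Z1 k" "f n \<noteq> 0"
    using finite_zeros finite_subset[of "Z1 k" "{n. f n = 0}"] by blast
  then obtain v where v: "padic_val p (f n) = ereal (real v)"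
    unfolding f padic_val_of_int by (metis of_int_0)
  obtain n' where n': "n' \<in> Z1 (k + Suc v)"
    using Z1_nonempty by blast
  then have "n' \<in> Z1 k"
    using root_class_antimono[of k "k + Suc v"] by auto
  then have "padic_val p (f n') = ereal (real v)"
    using t n(1) v unfolding terminating_def by metis
  then show False
    using val_ge_Z1[OF n'] by simp
qed

lemma Z1_child: "Z1 (Suc k) \<in> children p k (Z1 k)"
proof -
  obtain n where n: "n \<in> Z1 (Suc k)"
    using Z1_nonempty by blast
  then have n': "n \<in> Z1 k"
    using root_class_antimono[of k "Suc k"] by auto
  show ?thesis
    unfolding root_class_eq_residue_class[OF p a1 n] root_class_eq_residue_class[OF p a1 n']
      children_residue_class[OF p_pos]
    using residue_class_self by blast
qed

lemma children_Z1:
  shows "finite (children p k (Z1 k))" "card (children p k (Z1 k)) = p"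
    and "M \<in> children p k (Z1 k) \<Longrightarrow> M \<noteq> {} \<and> M \<subseteq> Z1 k"
    and "M \<in> children p k (Z1 k) \<Longrightarrow> n \<in> M \<Longrightarrow> M = residue_class (p ^ Suc k) n"
proof -
  obtain m where m: "m \<in> Z1 k"
    using Z1_nonempty by blast
  have res: "Z1 k = residue_class (p ^ k) m"
    using root_class_eq_residue_class[OF p a1 m] .
  show "finite (children p k (Z1 k))" "card (children p k (Z1 k)) = p"
    unfolding res using card_children_residue_class[OF p_pos] by auto
  show "M = residue_class (p ^ Suc k) n" if "M \<in> children p k (Z1 k)" "n \<in> M"
    using that residue_class_eqI unfolding res children_residue_class[OF p_pos] by blast
  show "M \<noteq> {} \<and> M \<subseteq> Z1 k" if M: "M \<in> children p k (Z1 k)"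
  proof -
    obtain x where x: "x \<in> residue_class (p ^ k) m" and Mx: "M = residue_class (p ^ Suc k) x"
      using M unfolding res children_residue_class[OF p_pos] by blast
    have "y mod p ^ k = x mod p ^ k" if "y mod p ^ Suc k = x mod p ^ Suc k" for y
      using that by (metis mod_mod_cancel le_imp_power_dvd le_SucI order_refl)
    then have "M \<subseteq> residue_class (p ^ k) x"
      unfolding Mx residue_class_def by blast
    also have "\<dots> = Z1 k"
      using residue_class_eqI[OF x] res by simp
    finally show ?thesis
      using Mx residue_class_self by blast
  qed
qed

lemma terminating_child_Z1:
  assumes M: "M \<in> children p k (Z1 k)" "M \<noteq> Z1 (Suc k)" "M \<noteq> Z2 (Suc k)"
  shows "has_valuation p f M (ereal (real (k + min k r)))"
  unfolding has_valuation_def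
proof
  fix n assume n: "n \<in> M"
  then have res: "M = residue_class (p ^ Suc k) n"
    using children_Z1(4)[OF M(1)] by blast
  have "n \<notin> Z1 (Suc k)" "n \<notin> Z2 (Suc k)"
    using root_class_eq_residue_class[OF p a1] root_class_eq_residue_class[OF p a2] res M
    by blast+
  moreover have "n \<in> Z1 k"
    using n children_Z1(3)[OF M(1)] by blast
  ultimately show "padic_val p (f n) = ereal (real (k + min k r))"
    using val_eq_Z1 by blast
qed

interpretation swap: two_integral_roots p r a2 b2 a1 b1 f
  by (rule swapped)

lemma nonterminating_children:
  assumes N: "N \<in> {Z1 k, Z2 k}"
  shows "{M \<in> children p k N. \<not> terminating p f M}
           = {Z1 (Suc k), Z2 (Suc k)} \<inter> children p k N"
    and "M \<in> children p k N \<Longrightarrow> terminating p f M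
           \<Longrightarrow> has_valuation p f M (ereal (real (k + min k r)))"
proof -
  have val: "has_valuation p f M (ereal (real (k + min k r)))"
    if "M \<in> children p k N" "M \<notin> {Z1 (Suc k), Z2 (Suc k)}" for M
    using that N terminating_child_Z1 swap.terminating_child_Z1 by blast
  show "{M \<in> children p k N. \<not> terminating p f M}
          = {Z1 (Suc k), Z2 (Suc k)} \<inter> children p k N"
  proof (intro equalityI subsetI)
    fix M assume M: "M \<in> {M \<in> children p k N. \<not> terminating p f M}"
    then have "\<not> has_valuation p f M v" for v
      unfolding has_valuation_def terminating_def by force
    then show "M \<in> {Z1 (Suc k), Z2 (Suc k)} \<inter> children p k N"
      using val M by blast
  qed (use nonterminating_Z1 swap.nonterminating_Z1 in blast)
  show "has_valuation p f M (ereal (real (k + min k r)))"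
    if "M \<in> children p k N" "terminating p f M"
    using that val nonterminating_Z1 swap.nonterminating_Z1 by blast
qed

text \<open>
  The splitting rule for all levels at once; the position of \<open>k\<close> relative to \<open>r\<close> only
  affects the number \<open>t\<close> of distinct root classes among the children.
\<close>

lemma splits_into_root_class:
  assumes N: "N \<in> {Z1 k, Z2 k}"
    and t: "card ({Z1 (Suc k), Z2 (Suc k)} \<inter> children p k N) = t"
  shows "splits_into p f k N (p - t) (ereal (real (k + min k r)))
           t (ereal (real (Suc k + min (Suc k) r)))"
proof -
  have fin: "finite (children p k N)" and card: "card (children p k N) = p"
    using N children_Z1(1,2) swap.children_Z1(1,2) by blast+
  have nont: "card {M \<in> children p k N. \<not> terminating p f M} = t"
    using nonterminating_children(1)[OF N] t by simp
  have "{M \<in> children p k N. terminating p f M}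
          = children p k N - {M \<in> children p k N. \<not> terminating p f M}"
    by blast
  then have "card {M \<in> children p k N. terminating p f M} = p - t"
    using fin card nont by (simp add: card_Diff_subset)
  moreover have "valuation_at_least p f M (ereal (real (Suc k + min (Suc k) r)))"
    if "M \<in> children p k N" "\<not> terminating p f M" for M
  proof -
    have "M \<in> {Z1 (Suc k), Z2 (Suc k)}"
      using that nonterminating_children(1)[OF N] by blast
    then show ?thesis
      unfolding valuation_at_least_def using val_ge_Z1 swap.val_ge_Z1 by blast
  qed
  ultimately show ?thesis
    unfolding splits_into_def using fin nont nonterminating_children(2)[OF N] by blast
qed

lemma nonterminating_level: "{M \<in> tree_level p f k. \<not> terminating p f M} = {Z1 k, Z2 k}"
proof (induction k)
  case 0
  have "\<not> terminating p f UNIV"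
    using nonterminating_Z1[of 0] by (simp add: Z1_0)
  then show ?case
    by (auto simp: Z1_0 Z2_0)
next
  case (Suc k)
  have "{M \<in> tree_level p f (Suc k). \<not> terminating p f M}
          = (\<Union>N\<in>{Z1 k, Z2 k}. {M \<in> children p k N. \<not> terminating p f M})"
    unfolding tree_level.simps Suc.IH by blast
  also have "\<dots> = (\<Union>N\<in>{Z1 k, Z2 k}. {Z1 (Suc k), Z2 (Suc k)} \<inter> children p k N)"
    using nonterminating_children(1) by (intro SUP_cong refl) blast
  also have "\<dots> = {Z1 (Suc k), Z2 (Suc k)}"
    using Z1_child[of k] swap.Z1_child[of k] by blast
  finally show ?case .
qed

lemma split_below:
  assumes "k < r"
  shows "\<exists>N. {M \<in> tree_level p f k. \<not> terminating p f M} = {N} \<and>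
    splits_into p f k N (p - 1) (ereal (real (2 * k))) 1 (ereal (real (2 * (k + 1))))"
proof (intro exI conjI)
  have eq: "Z2 k = Z1 k" "Z2 (Suc k) = Z1 (Suc k)"
    using assms Z1_eq_Z2[of k] Z1_eq_Z2[of "Suc k"] by auto
  show "{M \<in> tree_level p f k. \<not> terminating p f M} = {Z1 k}"
    unfolding nonterminating_level eq by simp
  have "{Z1 (Suc k), Z2 (Suc k)} \<inter> children p k (Z1 k) = {Z1 (Suc k)}"
    unfolding eq using Z1_child[of k] by blast
  then have "splits_into p f k (Z1 k) (p - 1) (ereal (real (k + min k r)))
           1 (ereal (real (Suc k + min (Suc k) r)))"
    by (intro splits_into_root_class) simp_all
  moreover have "k + min k r = 2 * k" "Suc k + min (Suc k) r = 2 * (k + 1)"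
    using assms by auto
  ultimately show "splits_into p f k (Z1 k) (p - 1) (ereal (real (2 * k)))
      1 (ereal (real (2 * (k + 1))))"
    by metis
qed

lemma split_at:
  "\<exists>N. {M \<in> tree_level p f r. \<not> terminating p f M} = {N} \<and>
    splits_into p f r N (p - 2) (ereal (real (2 * r))) 2 (ereal (real (2 * r + 1)))"
proof (intro exI conjI)
  have eq: "Z2 r = Z1 r"
    using Z1_eq_Z2[of r] by auto
  show "{M \<in> tree_level p f r. \<not> terminating p f M} = {Z1 r}"
    unfolding nonterminating_level eq by simp
  have "{Z1 (Suc r), Z2 (Suc r)} \<inter> children p r (Z1 r) = {Z1 (Suc r), Z2 (Suc r)}"
    using Z1_child[of r] swap.Z1_child[of r] unfolding eq by blast
  moreover have "Z1 (Suc r) \<noteq> Z2 (Suc r)"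
    using Z1_Z2_disjoint[of "Suc r"] Z1_nonempty by auto
  ultimately have "splits_into p f r (Z1 r) (p - 2) (ereal (real (r + min r r)))
           2 (ereal (real (Suc r + min (Suc r) r)))"
    by (intro splits_into_root_class) simp_all
  moreover have "r + min r r = 2 * r" "Suc r + min (Suc r) r = 2 * r + 1"
    by auto
  ultimately show "splits_into p f r (Z1 r) (p - 2) (ereal (real (2 * r)))
      2 (ereal (real (2 * r + 1)))"
    by metis
qed

lemma split_above:
  assumes k: "k \<ge> r + 1" and N: "N \<in> tree_level p f k" "\<not> terminating p f N"
  shows "splits_into p f k N (p - 1) (ereal (real (k + r))) 1 (ereal (real (k + 1 + r)))"
proof -
  have N': "N \<in> {Z1 k, Z2 k}"
    using N nonterminating_level by blast
  have "Z1 k \<inter> Z2 k = {}"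
    using Z1_Z2_disjoint k by auto
  moreover have "Z1 (Suc k) \<subseteq> Z1 k" "Z2 (Suc k) \<subseteq> Z2 k"
    using root_class_antimono[of k "Suc k"] by auto
  ultimately have "Z2 (Suc k) \<notin> children p k (Z1 k)" "Z1 (Suc k) \<notin> children p k (Z2 k)"
    using children_Z1(3)[of _ k] swap.children_Z1(3)[of _ k] by blast+
  then have "{Z1 (Suc k), Z2 (Suc k)} \<inter> children p k N = {Z1 (Suc k)} \<or>
             {Z1 (Suc k), Z2 (Suc k)} \<inter> children p k N = {Z2 (Suc k)}"
    using N' Z1_child[of k] swap.Z1_child[of k] by blast
  then have "card ({Z1 (Suc k), Z2 (Suc k)} \<inter> children p k N) = 1"
    by auto
  from splits_into_root_class[OF N' this]
  have "splits_into p f k N (p - 1) (ereal (real (k + min k r)))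
           1 (ereal (real (Suc k + min (Suc k) r)))" .
  moreover have "k + min k r = k + r" "Suc k + min (Suc k) r = k + 1 + r"
    using k by auto
  ultimately show ?thesis
    by metis
qed

end

section \<open>Equal roots, and a root that is not integral\<close>

text \<open>Reduced fractions that agree have the same numerator and denominator up to a common sign.\<close>

lemma coprime_equal_roots:
  fixes a1 b1 a2 b2 :: int
  assumes "a1 \<noteq> 0" "a2 \<noteq> 0" "gcd a1 b1 = 1" "gcd a2 b2 = 1" "b1 * a2 = b2 * a1"
  shows "a2 = a1 \<and> b2 = b1 \<or> a2 = - a1 \<and> b2 = - b1"
proof -
  have "a1 dvd b1 * a2"
    unfolding assms(5) by simp
  moreover have "a2 dvd b2 * a1"
    unfolding assms(5)[symmetric] by simp
  moreover have "coprime a1 b1" "coprime a2 b2"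
    using assms(3,4) by (simp_all add: coprime_iff_gcd_eq_1)
  ultimately have "a1 dvd a2" "a2 dvd a1"
    by (simp_all add: coprime_dvd_mult_right_iff)
  then have "\<bar>a1\<bar> = \<bar>a2\<bar>"
    by (rule zdvd_antisym_abs)
  then have "a2 = a1 \<or> a2 = - a1"
    by (auto simp: abs_eq_iff)
  then show ?thesis
  proof
    assume "a2 = a1"
    then show ?thesis
      using assms by simp
  next
    assume a2: "a2 = - a1"
    then have "a1 * b2 = a1 * (- b1)"
      using assms(5) by (simp add: algebra_simps)
    then show ?thesis
      using a2 assms(1) by (simp only: mult_cancel_left) auto
  qed
qed

lemma padic_val_equal_roots:
  assumes "prime p" "a1 \<noteq> 0" "a2 \<noteq> 0" "gcd a1 b1 = 1" "gcd a2 b2 = 1"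
    and "of_int b1 / of_int a1 = (of_int b2 / of_int a2 :: rat)"
  shows "padic_val p (of_int ((a1 * int n + b1) * (a2 * int n + b2)))
           = 2 * padic_val p (of_int (a1 * int n + b1))"
proof -
  have "(of_int (b1 * a2) :: rat) = of_int (b2 * a1)"
    using assms(2,3,6) by (simp add: field_simps)
  then have "b1 * a2 = b2 * a1"
    using of_int_eq_iff by blast
  then have "a2 = a1 \<and> b2 = b1 \<or> a2 = - a1 \<and> b2 = - b1"
    using coprime_equal_roots[OF assms(2-5)] by blast
  then have "padic_val p (of_int (a2 * int n + b2)) = padic_val p (of_int (a1 * int n + b1))"
  proof
    assume "a2 = - a1 \<and> b2 = - b1"
    then have "a2 * int n + b2 = - (a1 * int n + b1)"
      by (simp only: mult_minus_left minus_add_distrib)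
    moreover have "padic_val p (of_int (- x)) = padic_val p (of_int x)" for x
      by (simp only: padic_val_of_int multiplicity_uminus_right neg_equal_0_iff_equal)
    ultimately show "padic_val p (of_int (a2 * int n + b2)) = padic_val p (of_int (a1 * int n + b1))"
      by metis
  qed simp
  then have "padic_val p (of_int ((a1 * int n + b1) * (a2 * int n + b2)))
      = padic_val p (of_int (a1 * int n + b1)) + padic_val p (of_int (a1 * int n + b1))"
    by (simp only: padic_val_mult[OF assms(1)])
  also have "\<dots> = 2 * padic_val p (of_int (a1 * int n + b1))"
    by (cases "padic_val p (of_int (a1 * int n + b1))") simp_all
  finally show ?thesis .
qed

text \<open>
  If the second root is not \<open>p\<close>-integral, then \<open>p\<close> divides \<open>a2\<close> but not \<open>b2\<close>, so the second factor
  is never divisible by \<open>p\<close>.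
\<close>

lemma padic_val_nonintegral_root:
  assumes "prime p" "a2 \<noteq> 0" "gcd a2 b2 = 1" "- (of_int b2 / of_int a2) \<notin> padic_ints p"
  shows "padic_val p (of_int ((a1 * int n + b1) * (a2 * int n + b2)))
           = padic_val p (of_int (a1 * int n + b1))"
proof -
  have a2: "int p dvd a2"
    using root_in_padic_ints_iff[OF assms(1-3)] assms(4) by blast
  have "\<not> int p dvd b2"
  proof
    assume "int p dvd b2"
    then have "int p dvd gcd a2 b2"
      using a2 by simp
    then show False
      using assms(1,3) not_prime_unit[of "int p"] by auto
  qed
  then have "\<not> int p dvd a2 * int n + b2"
    using a2 by (simp add: dvd_add_right_iff)
  then have "padic_val p (of_int (a2 * int n + b2)) = ereal (real 0)"
    by (intro padic_val_eqI assms(1)) simp_all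
  then show ?thesis
    unfolding padic_val_mult[OF assms(1)] by (simp add: zero_ereal_def[symmetric])
qed

section \<open>The valuation tree of a product of two linear forms\<close>

theorem theorem4p3:
  fixes p :: nat and a1 b1 a2 b2 :: int
    and f g :: "nat \<Rightarrow> rat" and \<rho>1 \<rho>2 :: rat
  assumes "prime p"
    and "a1 \<noteq> 0" and "a2 \<noteq> 0"
    and "gcd a1 b1 = 1" and "gcd a2 b2 = 1"
    and f: "\<And>n. f n = of_int ((a1 * int n + b1) * (a2 * int n + b2))"
    and g: "\<And>n. g n = of_int (a1 * int n + b1)"
    and \<rho>1: "\<rho>1 = - (of_int b1 / of_int a1)"
    and \<rho>2: "\<rho>2 = - (of_int b2 / of_int a2)"
  shows "(\<rho>1 = \<rho>2 \<longrightarrow>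
            terminating_nodes p f = terminating_nodes p g \<and>
            nonterminating_nodes p f = nonterminating_nodes p g \<and>
            (\<forall>N\<in>terminating_nodes p g. \<forall>v.
               has_valuation p g N v \<longrightarrow> has_valuation p f N (2 * v)) \<and>
            (\<forall>N\<in>nonterminating_nodes p g. \<forall>m\<in>N.
               padic_val p (f m) = 2 * padic_val p (g m)))
       \<and> (\<rho>2 \<notin> padic_ints p \<longrightarrow>
            terminating_nodes p f = terminating_nodes p g \<and>
            nonterminating_nodes p f = nonterminating_nodes p g \<and>
            (\<forall>N\<in>terminating_nodes p g. \<forall>v.
               has_valuation p g N v \<longrightarrow> has_valuation p f N v))
       \<and> (\<forall>r::nat. \<rho>1 \<in> padic_ints p \<and> \<rho>2 \<in> padic_ints p \<and> \<rho>1 \<noteq> \<rho>2 \<and>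
            padic_cong p r \<rho>1 \<rho>2 \<and> \<not> padic_cong p (r + 1) \<rho>1 \<rho>2 \<longrightarrow>
            (\<forall>k<r. \<exists>N. {M \<in> tree_level p f k. \<not> terminating p f M} = {N} \<and>
               splits_into p f k N
                 (p - 1) (ereal (real (2 * k))) 1 (ereal (real (2 * (k + 1))))) \<and>
            (\<exists>N. {M \<in> tree_level p f r. \<not> terminating p f M} = {N} \<and>
               splits_into p f r N
                 (p - 2) (ereal (real (2 * r))) 2 (ereal (real (2 * r + 1)))) \<and>
            (\<forall>k\<ge>r + 1. \<forall>N\<in>tree_level p f k. \<not> terminating p f N \<longrightarrow>
               splits_into p f k N
                 (p - 1) (ereal (real (k + r))) 1 (ereal (real (k + 1 + r)))))"
proof (intro conjI[where P = "_ \<longrightarrow> _"] impI allI, goal_cases)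
  case 1
  have val: "padic_val p (f n) = 2 * padic_val p (g n)" for n
    unfolding f g using assms 1 by (intro padic_val_equal_roots) auto
  have double: "2 * x = 2 * y \<longleftrightarrow> x = y" for x y :: ereal
    by (cases x; cases y) auto
  have "terminating p f N \<longleftrightarrow> terminating p g N" for N
    unfolding terminating_def val double ..
  note nodes_cong[OF this]
  then show ?case
    by (simp add: val has_valuation_def)
next
  case 2
  have val: "padic_val p (f n) = padic_val p (g n)" for n
    unfolding f g using assms 2 by (intro padic_val_nonintegral_root) auto
  have "terminating p f N \<longleftrightarrow> terminating p g N" for N
    unfolding terminating_def val ..
  note nodes_cong[OF this]
  then show ?case
    by (simp add: val has_valuation_def)
next
  case (3 r)
  have nd: "\<not> int p dvd a1" "\<not> int p dvd a2"
    using 3 root_in_padic_ints_iff[OF assms(1,2,4)] root_in_padic_ints_iff[OF assms(1,3,5)]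
    unfolding \<rho>1 \<rho>2 by blast+
  have "int p ^ r dvd a1 * b2 - a2 * b1" "\<not> int p ^ Suc r dvd a1 * b2 - a2 * b1"
    using 3 unfolding \<rho>1 \<rho>2 padic_cong_roots_iff[OF assms(1) nd] by simp_all
  then interpret two_integral_roots p r a1 b1 a2 b2 f
    using assms(1) nd f by unfold_locales auto
  show ?case
    using split_below split_at split_above by blast
qed

end
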